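(* Let $X$ be an infinite set, $Y$ a moiety of $X$, and $G$ an inverse subsemigroup of $I_X$ satisfying $$\operatorname{Sym}(Y) \subseteq \{ g|_{Y} : g \in G\}.$$ A collection $\mathcal{M}$ of subsets of $I_X$ is the set of all maximal subsemigroups of $I_X$ which contain $G$ if and only if the following five conditions hold: (i) $G \subseteq M$ for all $M \in \mathcal{M}$; (ii) $M$ is a proper subsemigroup of $I_X$ for all $M \in \mathcal{M}$; (iii) $M \nsubseteq N$ for all distinct $M,N \in \mathcal{M}$; (iv) $M^{-1} \in \mathcal{M}$ for all $M \in \mathcal{M}$; (v) for all subsemigroups $U$ of $I_X$ such that $G \subseteq U$ and $U \nsubseteq M$ for all $M\in \mathcal{M}$, there exists a total $f \in U$ such that $\operatorname{im}(f)\subseteq Y$. Moreover, if the five conditions above are satisfied, then the maximal inverse subsemigroups of $I_X$ which contain $G$ are precisely the maximal elements of $\{M\cap M^{-1} : M \in \mathcal{M}\}$ under containment.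
   Context: $I_X$ denotes the symmetric inverse monoid on $X$: the set of all injective partial functions from $X$ to $X$ (bijections between subsets of $X$, including the empty one) under composition of partial functions; functions are written on the right of their arguments and composed from left to right; $f^{-1}$ is the inverse partial bijection. $\operatorname{dom}(f)$ and $\operatorname{im}(f)$ are the domain and image of $f$. $f$ is total if $\operatorname{dom}(f)=X$. For $A\subseteq X$, $f|_A=\{(x,y)\in f: x\in A\}$. A moiety of $X$ is a subset $Y\subseteq X$ with $|Y|=|X\setminus Y|=|X|$. $\operatorname{Sym}(Y)$ is the set of all permutations of $Y$, viewed as elements of $I_X$ with domain and image $Y$. For $M\subseteq I_X$, $M^{-1}=\{f^{-1}: f\in M\}$. An inverse subsemigroup is a subsemigroup closed under $f\mapsto f^{-1}$. A maximal subsemigroup (respectively maximal inverse subsemigroup) is a maximal element, under containment, of the set of all proper subsemigroups (respectively proper inverse subsemigroups). *)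

theory Defs
  imports Main "HOL-Library.Equipollence"
begin

text \<open>
  Partial functions are represented by their graphs.  Since functions are written on the right of
  their arguments and composed from left to right, the product of \<open>f\<close> and \<open>g\<close> is the relational
  composition \<open>f O g\<close>, the inverse of \<open>f\<close> is \<open>f\<inverse>\<close>, and the domain and image of \<open>f\<close> are \<open>Domain f\<close>
  and \<open>Range f\<close>.
\<close>

definition sym_inv_monoid :: "'a set \<Rightarrow> 'a rel set" where
  "sym_inv_monoid X = {f. f \<subseteq> X \<times> X \<and> single_valued f \<and> single_valued (f\<inverse>)}"

definition sym_group_on :: "'a set \<Rightarrow> 'a rel set" where
  "sym_group_on Y = {f \<in> sym_inv_monoid Y. Domain f = Y \<and> Range f = Y}"

definition restrict_dom :: "'a rel \<Rightarrow> 'a set \<Rightarrow> 'a rel" where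
  "restrict_dom f A = {(x, y). (x, y) \<in> f \<and> x \<in> A}"

definition total_pfun :: "'a set \<Rightarrow> 'a rel \<Rightarrow> bool" where
  "total_pfun X f \<longleftrightarrow> Domain f = X"

definition moiety :: "'a set \<Rightarrow> 'a set \<Rightarrow> bool" where
  "moiety X Y \<longleftrightarrow> Y \<subseteq> X \<and> Y \<approx> X \<and> X - Y \<approx> X"

definition inverse_set :: "'a rel set \<Rightarrow> 'a rel set" where
  "inverse_set M = converse ` M"

text \<open>
  The empty set counts as a subsemigroup.  This is immaterial for subsemigroups containing a given
  nonempty set.
\<close>

definition subsemigroup :: "'a set \<Rightarrow> 'a rel set \<Rightarrow> bool" where
  "subsemigroup X S \<longleftrightarrow> S \<subseteq> sym_inv_monoid X \<and> (\<forall>f\<in>S. \<forall>g\<in>S. f O g \<in> S)"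

definition inverse_subsemigroup :: "'a set \<Rightarrow> 'a rel set \<Rightarrow> bool" where
  "inverse_subsemigroup X S \<longleftrightarrow> subsemigroup X S \<and> (\<forall>f\<in>S. f\<inverse> \<in> S)"

definition proper_subsemigroup :: "'a set \<Rightarrow> 'a rel set \<Rightarrow> bool" where
  "proper_subsemigroup X S \<longleftrightarrow> subsemigroup X S \<and> S \<noteq> sym_inv_monoid X"

definition proper_inverse_subsemigroup :: "'a set \<Rightarrow> 'a rel set \<Rightarrow> bool" where
  "proper_inverse_subsemigroup X S \<longleftrightarrow> inverse_subsemigroup X S \<and> S \<noteq> sym_inv_monoid X"

definition maximal_elements :: "'b set set \<Rightarrow> 'b set set" where
  "maximal_elements \<A> = {M \<in> \<A>. \<forall>N\<in>\<A>. M \<subseteq> N \<longrightarrow> N = M}"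

definition maximal_subsemigroup :: "'a set \<Rightarrow> 'a rel set \<Rightarrow> bool" where
  "maximal_subsemigroup X M \<longleftrightarrow> M \<in> maximal_elements {S. proper_subsemigroup X S}"

definition maximal_inverse_subsemigroup :: "'a set \<Rightarrow> 'a rel set \<Rightarrow> bool" where
  "maximal_inverse_subsemigroup X M \<longleftrightarrow>
     M \<in> maximal_elements {S. proper_inverse_subsemigroup X S}"

definition five_conditions ::
  "'a set \<Rightarrow> 'a set \<Rightarrow> 'a rel set \<Rightarrow> 'a rel set set \<Rightarrow> bool" where
  "five_conditions X Y G \<M> \<longleftrightarrow>
     (\<forall>M\<in>\<M>. G \<subseteq> M) \<and>
     (\<forall>M\<in>\<M>. proper_subsemigroup X M) \<and>
     (\<forall>M\<in>\<M>. \<forall>N\<in>\<M>. M \<noteq> N \<longrightarrow> \<not> M \<subseteq> N) \<and>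
     (\<forall>M\<in>\<M>. inverse_set M \<in> \<M>) \<and>
     (\<forall>U. subsemigroup X U \<and> G \<subseteq> U \<and> (\<forall>M\<in>\<M>. \<not> U \<subseteq> M) \<longrightarrow>
        (\<exists>f\<in>U. total_pfun X f \<and> Range f \<subseteq> Y))"

end

theory Submission
  imports Defs
begin

text \<open>
  Everything rests on one generation fact: a subsemigroup \<open>U\<close> containing \<open>G\<close> is all of \<open>I\<^sub>X\<close> as soon
  as it contains a total map \<open>f\<close> into \<open>Y\<close> and the inverse \<open>h\<close> of another such map.  Indeed, after
  squaring, \<open>Y - im f\<close> and \<open>Y - dom h\<close> both have size \<open>|X|\<close>.  An arbitrary \<open>s \<in> I\<^sub>X\<close> then factors
  as \<open>s = t h\<close> with \<open>t\<close> a total map into \<open>Y\<close>: on \<open>dom s\<close> it is \<open>s h\<^sup>-\<^sup>1\<close>, and the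
  points outside \<open>dom s\<close> are hidden in \<open>Y - dom h\<close>, using only half of it.  Now \<open>f\<close> and \<open>t\<close> are
  two embeddings of \<open>X\<close> into \<open>Y\<close> whose images have complements of equal size, so some \<open>a \<in> Sym(Y)\<close>
  carries one to the other, and \<open>s = f a h\<close>.  As \<open>a\<close> is the restriction to \<open>Y\<close> of some \<open>g \<in> G\<close>
  and \<open>f\<close> maps into \<open>Y\<close>, also \<open>s = f g h \<in> U\<close>.  This is lemma \<open>generation_by_embeddings\<close>.

  There are two consequences.  First, \<open>I\<^sub>X\<close> is generated by \<open>G\<close> and two further elements, so Zorn's
  lemma puts every proper subsemigroup containing \<open>G\<close> inside a maximal one; this is why the set of
  all maximal subsemigroups satisfies (v).  Second, under (iv) and (v) a subsemigroup \<open>U\<close> containing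
  \<open>G\<close> that lies in no member of \<open>\<M>\<close> must be \<open>I\<^sub>X\<close>: condition (v) yields \<open>f\<close> when applied to \<open>U\<close>
  and \<open>h\<close> when applied to \<open>U\<^sup>-\<^sup>1\<close>.  So every proper subsemigroup
  containing \<open>G\<close> lies in a member of \<open>\<M>\<close>.  With (iii) this identifies \<open>\<M>\<close>, and it bounds every
  proper inverse subsemigroup containing \<open>G\<close> by some \<open>M \<inter> M\<^sup>-\<^sup>1\<close>, which is the last claim.
\<close>

section \<open>The symmetric inverse monoid and its involution\<close>

lemma sym_inv_monoidD:
  assumes "f \<in> sym_inv_monoid X"
  shows "f \<subseteq> X \<times> X" "single_valued f" "single_valued (f\<inverse>)"
  using assms by (auto simp: sym_inv_monoid_def)

lemma sym_inv_monoid_comp: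
  assumes "f \<in> sym_inv_monoid X" "g \<in> sym_inv_monoid X"
  shows "f O g \<in> sym_inv_monoid X"
  using assms unfolding sym_inv_monoid_def single_valued_def by blast

lemma single_valued_Un:
  assumes "single_valued f" "single_valued g" "Domain f \<inter> Domain g = {}"
  shows "single_valued (f \<union> g)"
proof (rule single_valuedI)
  fix x y z assume "(x, y) \<in> f \<union> g" "(x, z) \<in> f \<union> g"
  then show "y = z"
    using assms by (auto dest: single_valuedD)
qed

lemma sym_inv_monoid_Un:
  assumes "f \<in> sym_inv_monoid X" "g \<in> sym_inv_monoid X"
    and "Domain f \<inter> Domain g = {}" "Range f \<inter> Range g = {}"
  shows "f \<union> g \<in> sym_inv_monoid X"
  using assms single_valued_Un[of f g] single_valued_Un[of "f\<inverse>" "g\<inverse>"]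
  by (simp add: sym_inv_monoid_def converse_Un)

lemma sym_inv_monoid_converse_iff [simp]:
  "f\<inverse> \<in> sym_inv_monoid X \<longleftrightarrow> f \<in> sym_inv_monoid X"
  unfolding sym_inv_monoid_def by auto

lemma inverse_set_iff [simp]: "f \<in> inverse_set M \<longleftrightarrow> f\<inverse> \<in> M"
  unfolding inverse_set_def by (metis converse_converse image_iff)

lemma inverse_set_inverse_set [simp]: "inverse_set (inverse_set M) = M"
  by auto

lemma inverse_set_mono_iff [simp]: "inverse_set M \<subseteq> inverse_set N \<longleftrightarrow> M \<subseteq> N"
  by (simp add: inverse_set_def inj_image_subset_iff inj_on_def)

lemma inverse_set_sym_inv_monoid [simp]: "inverse_set (sym_inv_monoid X) = sym_inv_monoid X"
  by auto

lemma inverse_set_inverse_subsemigroup: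
  assumes "inverse_subsemigroup X S"
  shows "inverse_set S = S"
proof -
  have inv: "f\<inverse> \<in> S" if "f \<in> S" for f
    using assms that by (simp add: inverse_subsemigroup_def)
  have "f\<inverse> \<in> S \<longleftrightarrow> f \<in> S" for f
    using inv[of f] inv[of "f\<inverse>"] by auto
  then show ?thesis
    by (intro set_eqI) (simp only: inverse_set_iff)
qed

lemma subsemigroup_inverse_set:
  assumes "subsemigroup X S"
  shows "subsemigroup X (inverse_set S)"
  using assms unfolding subsemigroup_def by (auto simp: converse_relcomp subset_iff)

lemma proper_subsemigroup_inverse_set:
  assumes "proper_subsemigroup X S"
  shows "proper_subsemigroup X (inverse_set S)"
proof -
  have "inverse_set S \<noteq> sym_inv_monoid X"
    using assms inverse_set_inverse_set[of S] inverse_set_sym_inv_monoid[of X]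
    by (auto simp: proper_subsemigroup_def simp del: inverse_set_inverse_set)
  then show ?thesis
    using assms by (simp add: proper_subsemigroup_def subsemigroup_inverse_set)
qed

lemma maximal_subsemigroup_inverse_set:
  assumes "maximal_subsemigroup X M"
  shows "maximal_subsemigroup X (inverse_set M)"
proof -
  have proper: "proper_subsemigroup X M"
    and max: "\<And>N. proper_subsemigroup X N \<Longrightarrow> M \<subseteq> N \<Longrightarrow> N = M"
    using assms by (auto simp: maximal_subsemigroup_def maximal_elements_def)
  have "N = inverse_set M" if "proper_subsemigroup X N" "inverse_set M \<subseteq> N" for N
    using max[OF proper_subsemigroup_inverse_set[OF that(1)]] that(2)
      inverse_set_mono_iff[of "inverse_set M" N] by auto
  then show ?thesis
    using proper_subsemigroup_inverse_set[OF proper]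
    by (auto simp: maximal_subsemigroup_def maximal_elements_def)
qed

lemma proper_inverse_subsemigroup_Int_inverse_set:
  assumes "proper_subsemigroup X M"
  shows "proper_inverse_subsemigroup X (M \<inter> inverse_set M)"
  using assms subsemigroup_inverse_set[of X M]
  unfolding proper_inverse_subsemigroup_def inverse_subsemigroup_def proper_subsemigroup_def
    subsemigroup_def by auto

section \<open>Factorisation through the symmetric group on a moiety\<close>

lemma partial_bijection_extends_to_permutation:
  assumes p: "p \<in> sym_inv_monoid Y" and eq: "Y - Domain p \<approx> Y - Range p"
  shows "\<exists>a\<in>sym_group_on Y. p \<subseteq> a"
proof -
  obtain k where k: "bij_betw k (Y - Domain p) (Y - Range p)"
    using eq by (auto simp: eqpoll_def)
  define q where "q = {(y, k y) | y. y \<in> Y - Domain p}"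
  have q: "q \<subseteq> Y \<times> Y" "single_valued q" "single_valued (q\<inverse>)"
    "Domain q = Y - Domain p" "Range q = Y - Range p"
    using k unfolding q_def bij_betw_def inj_on_def single_valued_def by blast+
  have "p \<union> q \<in> sym_inv_monoid Y"
    using q by (intro sym_inv_monoid_Un p) (auto simp: sym_inv_monoid_def)
  moreover have "Domain (p \<union> q) = Y" "Range (p \<union> q) = Y"
    using sym_inv_monoidD(1)[OF p] q(4,5) by blast+
  ultimately show ?thesis
    unfolding sym_group_on_def by blast
qed

text \<open>
  Two embeddings of \<open>X\<close> with large co-image in \<open>Y\<close> differ by a permutation of \<open>Y\<close>: the partial
  bijection \<open>f\<^sup>-\<^sup>1 t\<close> matches the images, and the two complements have size \<open>|X|\<close>.
\<close>

lemma embeddings_differ_by_permutation: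
  assumes YX: "Y \<subseteq> X"
    and f: "f \<in> sym_inv_monoid X" "Domain f = X" "Range f \<subseteq> Y" "X \<lesssim> Y - Range f"
    and t: "t \<in> sym_inv_monoid X" "Domain t = X" "Range t \<subseteq> Y" "X \<lesssim> Y - Range t"
  shows "\<exists>a\<in>sym_group_on Y. f O a = t"
proof -
  note f' = sym_inv_monoidD[OF f(1)] and t' = sym_inv_monoidD[OF t(1)]
  define p where "p = f\<inverse> O t"
  have "p \<in> sym_inv_monoid X"
    using f(1) t(1) by (simp add: p_def sym_inv_monoid_comp)
  moreover have "p \<subseteq> Y \<times> Y"
    using f(3) t(3) by (auto simp: p_def)
  ultimately have p: "p \<in> sym_inv_monoid Y"
    by (simp add: sym_inv_monoid_def)
  have dom: "Domain p = Range f" and ran: "Range p = Range t"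
    using f(2) t(2) f'(1) t'(1) unfolding p_def by blast+
  have "Y - Range f \<lesssim> X" "Y - Range t \<lesssim> X"
    using YX by (auto intro!: subset_imp_lepoll)
  then have "Y - Range f \<approx> Y - Range t"
    using f(4) t(4) by (meson lepoll_antisym lepoll_trans)
  then obtain a where a: "a \<in> sym_group_on Y" "p \<subseteq> a"
    using partial_bijection_extends_to_permutation[OF p] dom ran by auto
  have "single_valued a"
    using a(1) by (simp add: sym_group_on_def sym_inv_monoid_def)
  then have "f O a = f O p"
    using a(2) dom unfolding single_valued_def by blast
  also have "\<dots> = t"
    using f'(1,3) f(2) t'(1) unfolding p_def single_valued_def by blast
  finally show ?thesis
    using a(1) by blast
qed

text \<open>
  A point outside \<open>dom s\<close> must still have a value under the total map \<open>t\<close>, but one that \<open>h\<close> does not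
  see; the room for this is \<open>Y - dom h\<close>.  Filling only half of it keeps the co-image of \<open>t\<close> large.
\<close>

lemma factor_through_embedding:
  assumes Y: "moiety X Y"
    and h: "h \<in> sym_inv_monoid X" "Range h = X" "Domain h \<subseteq> Y" "X \<lesssim> Y - Domain h"
    and s: "s \<in> sym_inv_monoid X"
  shows "\<exists>t\<in>sym_inv_monoid X. Domain t = X \<and> Range t \<subseteq> Y \<and> X \<lesssim> Y - Range t \<and> t O h = s"
proof -
  note h' = sym_inv_monoidD[OF h(1)] and s' = sym_inv_monoidD[OF s]
  have YX: "Y \<subseteq> X" and "X \<approx> Y" and co: "X \<approx> X - Y"
    using Y by (auto simp: moiety_def eqpoll_sym)
  then obtain e where e: "bij_betw e X Y"
    by (auto simp: eqpoll_def)
  obtain k where k: "inj_on k X" "k ` X \<subseteq> Y - Domain h"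
    using h(4) by (auto simp: lepoll_def)
  \<comment> \<open>Passing through \<open>Y\<close> before applying \<open>k\<close> leaves the values of \<open>k\<close> on \<open>X - Y\<close> unused.\<close>
  define j where "j x = k (e x)" for x
  define q where "q = {(x, j x) | x. x \<in> X - Domain s}"
  have e': "inj_on e X" "e ` X = Y"
    using e by (auto simp: bij_betw_def)
  have j_in: "j x \<in> k ` Y" if "x \<in> X" for x
    using that e'(2) by (auto simp: j_def)
  have kY: "k ` Y \<subseteq> Y - Domain h"
    using k(2) YX by blast
  have j_inj: "inj_on j X"
    using e' k(1) YX unfolding j_def inj_on_def by blast
  have ran_q: "Range q \<subseteq> k ` Y"
    using j_in by (auto simp: q_def)
  have q: "q \<subseteq> X \<times> X" "single_valued q" "single_valued (q\<inverse>)" "Domain q = X - Domain s"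
    using ran_q kY YX j_inj unfolding q_def single_valued_def inj_on_def by blast+
  define r where "r = s O h\<inverse>"
  have r: "r \<in> sym_inv_monoid X"
    using s h(1) by (simp add: r_def sym_inv_monoid_comp)
  have dom_r: "Domain r = Domain s"
    using s'(1) h(2) unfolding r_def by blast
  have ran_r: "Range r \<subseteq> Domain h"
    by (auto simp: r_def)
  have disj: "Range r \<inter> Range q = {}" "Domain r \<inter> Domain q = {}"
    using ran_r ran_q kY dom_r q(4) by blast+
  have "r \<union> q \<in> sym_inv_monoid X"
    using q(1-3) disj by (intro sym_inv_monoid_Un r) (auto simp: sym_inv_monoid_def)
  moreover have "Domain (r \<union> q) = X"
    using dom_r q(4) s'(1) by blast
  moreover have "Range (r \<union> q) \<subseteq> Y"
    using ran_r ran_q kY h(3) by blast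
  moreover have "X \<lesssim> Y - Range (r \<union> q)"
  proof -
    have "X - Y \<lesssim> k ` (X - Y)"
      using k(1) by (meson Diff_subset inj_on_image_eqpoll_self eqpoll_imp_lepoll eqpoll_sym
          inj_on_subset)
    moreover have "k ` (X - Y) \<subseteq> Y - Range (r \<union> q)"
    proof -
      have "k ` (X - Y) = k ` X - k ` Y"
        using k(1) YX by (simp add: inj_on_image_set_diff)
      also have "\<dots> \<subseteq> (Y - Domain h) - k ` Y"
        using k(2) by (rule Diff_mono) simp
      also have "\<dots> = Y - (Domain h \<union> k ` Y)"
        by (simp only: set_diff_eq Un_iff de_Morgan_disj conj_assoc mem_Collect_eq)
      also have "\<dots> \<subseteq> Y - Range (r \<union> q)"
        using Un_mono[OF ran_r ran_q] by (intro Diff_mono) (simp_all add: Range_Un_eq)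
      finally show ?thesis .
    qed
    ultimately show ?thesis
      using co by (meson eqpoll_imp_lepoll lepoll_trans subset_imp_lepoll)
  qed
  moreover have "(r \<union> q) O h = s"
  proof -
    have "r O h = s"
      using h' h(2) s'(1) unfolding r_def single_valued_def by blast
    moreover have "q O h = {}"
      using ran_q kY by blast
    ultimately show ?thesis
      by (simp add: relcomp_distrib2)
  qed
  ultimately show ?thesis
    by blast
qed

section \<open>Generation by two embeddings\<close>

text \<open>
  Squaring enlarges the co-image: \<open>f f\<close> misses \<open>(X - Y) f\<close>, a part of \<open>Y\<close> of size \<open>|X|\<close>.
\<close>

lemma embedding_square:
  assumes Y: "moiety X Y"
    and f: "f \<in> sym_inv_monoid X" "Domain f = X" "Range f \<subseteq> Y"
  shows "Domain (f O f) = X" "Range (f O f) \<subseteq> Y" "X \<lesssim> Y - Range (f O f)"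
proof -
  note f' = sym_inv_monoidD[OF f(1)]
  have co: "X \<approx> X - Y"
    using Y by (auto simp: moiety_def eqpoll_sym)
  show "Domain (f O f) = X" "Range (f O f) \<subseteq> Y"
    using f f'(1) by blast+
  define F where "F x = (SOME y. (x, y) \<in> f)" for x
  have F: "(x, F x) \<in> f" if "x \<in> X" for x
    using that f(2) unfolding F_def by (metis DomainE someI_ex)
  have "inj_on F (X - Y)"
    using F f'(3) unfolding inj_on_def single_valued_def by (metis DiffD1 converse_iff)
  moreover have "F ` (X - Y) \<subseteq> Y - Range (f O f)"
    using F f(3) f'(3) unfolding single_valued_def by blast
  ultimately have "X - Y \<lesssim> Y - Range (f O f)"
    by (auto simp: lepoll_def)
  then show "X \<lesssim> Y - Range (f O f)"
    using co by (meson eqpoll_imp_lepoll lepoll_trans)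
qed

lemma generation_by_embeddings:
  assumes Y: "moiety X Y"
    and sym: "sym_group_on Y \<subseteq> {restrict_dom g Y | g. g \<in> G}"
    and U: "subsemigroup X U" "G \<subseteq> U"
    and f: "f \<in> U" "total_pfun X f" "Range f \<subseteq> Y"
    and h: "h \<in> inverse_set U" "total_pfun X h" "Range h \<subseteq> Y"
  shows "U = sym_inv_monoid X"
proof
  show "U \<subseteq> sym_inv_monoid X"
    using U(1) by (simp add: subsemigroup_def)
  have UU: "x O y \<in> U" if "x \<in> U" "y \<in> U" for x y
    using U(1) that by (simp add: subsemigroup_def)
  have fI: "f \<in> sym_inv_monoid X"
    using f(1) \<open>U \<subseteq> sym_inv_monoid X\<close> by blast
  have hI: "h \<in> sym_inv_monoid X"
    using h(1) \<open>U \<subseteq> sym_inv_monoid X\<close> by auto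
  define f2 where "f2 = f O f"
  define h2 where "h2 = h\<inverse> O h\<inverse>"
  have in_U: "f2 \<in> U" "h2 \<in> U"
    using f(1) h(1) UU by (auto simp: f2_def h2_def)
  have f2: "f2 \<in> sym_inv_monoid X" "Domain f2 = X" "Range f2 \<subseteq> Y" "X \<lesssim> Y - Range f2"
    using embedding_square[OF Y fI _ f(3)] f(2) fI
    by (simp_all add: f2_def total_pfun_def sym_inv_monoid_comp)
  have h2_conv: "h2 = (h O h)\<inverse>"
    by (simp add: h2_def converse_relcomp)
  have h2: "h2 \<in> sym_inv_monoid X" "Range h2 = X" "Domain h2 \<subseteq> Y" "X \<lesssim> Y - Domain h2"
    using embedding_square[OF Y hI _ h(3)] h(2) hI
    by (simp_all add: h2_conv total_pfun_def sym_inv_monoid_comp del: converse_relcomp)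
  show "sym_inv_monoid X \<subseteq> U"
  proof
    fix s assume s: "s \<in> sym_inv_monoid X"
    obtain t where t: "t \<in> sym_inv_monoid X" "Domain t = X" "Range t \<subseteq> Y" "X \<lesssim> Y - Range t"
      and ths: "t O h2 = s"
      using factor_through_embedding[OF Y h2 s] by blast
    have "Y \<subseteq> X"
      using Y by (simp add: moiety_def)
    then obtain a where a: "a \<in> sym_group_on Y" "f2 O a = t"
      using embeddings_differ_by_permutation[OF _ f2 t] by blast
    then obtain g where g: "g \<in> G" "a = restrict_dom g Y"
      using sym by blast
    \<comment> \<open>As \<open>f2\<close> maps into \<open>Y\<close>, composing with \<open>g\<close> or with its restriction to \<open>Y\<close> is the same.\<close>
    have "f2 O g = f2 O a"
      using f2(3) unfolding g(2) restrict_dom_def by blast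
    then have "s = (f2 O g) O h2"
      using a(2) ths by simp
    then show "s \<in> U"
      using UU in_U g(1) U(2) by blast
  qed
qed

lemma embedding_into_moiety_exists:
  assumes "moiety X Y"
  shows "\<exists>f\<in>sym_inv_monoid X. total_pfun X f \<and> Range f \<subseteq> Y"
proof -
  obtain e where "bij_betw e X Y" and "Y \<subseteq> X"
    using assms by (metis moiety_def eqpoll_def eqpoll_sym)
  then have "{(x, e x) | x. x \<in> X} \<in> sym_inv_monoid X"
    "Domain {(x, e x) | x. x \<in> X} = X" "Range {(x, e x) | x. x \<in> X} \<subseteq> Y"
    unfolding sym_inv_monoid_def single_valued_def bij_betw_def inj_on_def by blast+
  then show ?thesis
    unfolding total_pfun_def by blast
qed

text \<open>
  A union of a chain of proper subsemigroups stays proper because \<open>I\<^sub>X\<close> is finitely generated over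
  \<open>G\<close>: a union equal to \<open>I\<^sub>X\<close> would have both an embedding and its inverse in a single member of
  the chain, and that member would then be \<open>I\<^sub>X\<close>.
\<close>

lemma proper_subsemigroup_below_maximal:
  assumes Y: "moiety X Y"
    and sym: "sym_group_on Y \<subseteq> {restrict_dom g Y | g. g \<in> G}"
    and U: "proper_subsemigroup X U" "G \<subseteq> U"
  shows "\<exists>M. maximal_subsemigroup X M \<and> U \<subseteq> M"
proof -
  obtain f where f: "f \<in> sym_inv_monoid X" "total_pfun X f" "Range f \<subseteq> Y"
    using embedding_into_moiety_exists[OF Y] by blast
  define \<A> where "\<A> = {S. proper_subsemigroup X S \<and> U \<subseteq> S}"
  have "\<exists>M\<in>\<A>. \<forall>N\<in>\<A>. M \<subseteq> N \<longrightarrow> N = M"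
  proof (rule subset_Zorn_nonempty)
    show "\<A> \<noteq> {}"
      using U by (auto simp: \<A>_def)
  next
    fix \<C> assume "\<C> \<noteq> {}" and chain: "subset.chain \<A> \<C>"
    have CA: "\<C> \<subseteq> \<A>"
      using chain by (simp add: subset_chain_def)
    have common: "\<exists>S\<in>\<C>. x \<in> S \<and> y \<in> S" if "x \<in> \<Union>\<C>" "y \<in> \<Union>\<C>" for x y
      using that chain unfolding subset_chain_def by blast
    have semi: "subsemigroup X S" "S \<noteq> sym_inv_monoid X" "U \<subseteq> S" if "S \<in> \<C>" for S
      using that CA by (auto simp: \<A>_def proper_subsemigroup_def)
    have "subsemigroup X (\<Union>\<C>)"
      unfolding subsemigroup_def
    proof (intro conjI ballI)
      show "\<Union>\<C> \<subseteq> sym_inv_monoid X"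
        using semi(1) unfolding subsemigroup_def by blast
      show "x O y \<in> \<Union>\<C>" if xy: "x \<in> \<Union>\<C>" "y \<in> \<Union>\<C>" for x y
        using common[OF xy] semi(1) unfolding subsemigroup_def by blast
    qed
    moreover have "\<Union>\<C> \<noteq> sym_inv_monoid X"
    proof
      assume eq: "\<Union>\<C> = sym_inv_monoid X"
      then obtain S where S: "S \<in> \<C>" "f \<in> S" "f\<inverse> \<in> S"
        using common[of f "f\<inverse>"] f(1) by auto
      have "S = sym_inv_monoid X"
        using generation_by_embeddings[OF Y sym semi(1)[OF S(1)] _ S(2) f(2,3) _ f(2,3)]
          S(3) semi(3)[OF S(1)] U(2) by auto
      then show False
        using semi(2)[OF S(1)] by simp
    qed
    moreover have "U \<subseteq> \<Union>\<C>"
      using \<open>\<C> \<noteq> {}\<close> semi(3) by blast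
    ultimately show "\<Union>\<C> \<in> \<A>"
      by (simp add: \<A>_def proper_subsemigroup_def)
  qed
  then obtain M where M: "M \<in> \<A>" and max: "\<And>N. N \<in> \<A> \<Longrightarrow> M \<subseteq> N \<Longrightarrow> N = M"
    by blast
  have "N = M" if "proper_subsemigroup X N" "M \<subseteq> N" for N
    using that M by (intro max) (auto simp: \<A>_def)
  then have "maximal_subsemigroup X M"
    using M by (auto simp: \<A>_def maximal_subsemigroup_def maximal_elements_def)
  then show ?thesis
    using M by (auto simp: \<A>_def)
qed

section \<open>The five conditions\<close>

text \<open>
  In the presence of \<open>G\<close>, the embedding promised by (v) for \<open>U\<close> and the one for \<open>U\<^sup>-\<^sup>1\<close>, which
  avoids \<open>\<M>\<close> together with \<open>U\<close> by (iv), generate everything.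
\<close>

lemma proper_subsemigroup_below_member:
  assumes Y: "moiety X Y" and G: "inverse_subsemigroup X G"
    and sym: "sym_group_on Y \<subseteq> {restrict_dom g Y | g. g \<in> G}"
    and five: "five_conditions X Y G \<M>"
    and U: "proper_subsemigroup X U" "G \<subseteq> U"
  shows "\<exists>M\<in>\<M>. U \<subseteq> M"
proof (rule ccontr)
  assume none: "\<not> (\<exists>M\<in>\<M>. U \<subseteq> M)"
  have embed: "\<exists>f\<in>V. total_pfun X f \<and> Range f \<subseteq> Y"
    if "subsemigroup X V" "G \<subseteq> V" "\<forall>M\<in>\<M>. \<not> V \<subseteq> M" for V
    using five that unfolding five_conditions_def by blast
  have inv: "inverse_set M \<in> \<M>" if "M \<in> \<M>" for M
    using five that unfolding five_conditions_def by blast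
  have semi: "subsemigroup X U" and ne: "U \<noteq> sym_inv_monoid X"
    using U(1) by (auto simp: proper_subsemigroup_def)
  obtain f where f: "f \<in> U" "total_pfun X f" "Range f \<subseteq> Y"
    using embed[OF semi U(2)] none by blast
  have "G \<subseteq> inverse_set U"
    using inverse_set_mono_iff[of G U] inverse_set_inverse_subsemigroup[OF G] U(2) by simp
  moreover have "\<forall>M\<in>\<M>. \<not> inverse_set U \<subseteq> M"
    using none inv by (metis inverse_set_inverse_set inverse_set_mono_iff)
  ultimately obtain h where h: "h \<in> inverse_set U" "total_pfun X h" "Range h \<subseteq> Y"
    using embed[OF subsemigroup_inverse_set[OF semi]] by blast
  show False
    using generation_by_embeddings[OF Y sym semi U(2) f h] ne by blast
qed

lemma maximal_subsemigroups_satisfy_five_conditions: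
  assumes Y: "moiety X Y" and G: "inverse_subsemigroup X G"
    and sym: "sym_group_on Y \<subseteq> {restrict_dom g Y | g. g \<in> G}"
  shows "five_conditions X Y G {M. maximal_subsemigroup X M \<and> G \<subseteq> M}"
  unfolding five_conditions_def
proof (intro conjI ballI allI impI)
  fix U
  assume U: "subsemigroup X U \<and> G \<subseteq> U \<and> (\<forall>M\<in>{M. maximal_subsemigroup X M \<and> G \<subseteq> M}. \<not> U \<subseteq> M)"
  have "\<not> proper_subsemigroup X U"
  proof
    assume "proper_subsemigroup X U"
    then obtain M where M: "maximal_subsemigroup X M" "U \<subseteq> M"
      using proper_subsemigroup_below_maximal[OF Y sym] U by meson
    moreover have "G \<subseteq> M"
      using U M(2) by (meson subset_trans)
    ultimately show False
      using U by simp
  qed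
  then have "U = sym_inv_monoid X"
    using U by (simp add: proper_subsemigroup_def)
  then show "\<exists>f\<in>U. total_pfun X f \<and> Range f \<subseteq> Y"
    using embedding_into_moiety_exists[OF Y] by simp
next
  fix M assume M: "M \<in> {M. maximal_subsemigroup X M \<and> G \<subseteq> M}"
  then have "G \<subseteq> inverse_set M"
    using inverse_set_mono_iff[of G M] inverse_set_inverse_subsemigroup[OF G] by simp
  then show "inverse_set M \<in> {M. maximal_subsemigroup X M \<and> G \<subseteq> M}"
    using M maximal_subsemigroup_inverse_set by blast
qed (auto simp: maximal_subsemigroup_def maximal_elements_def)

lemma five_conditions_imp_maximal_subsemigroups:
  assumes Y: "moiety X Y" and G: "inverse_subsemigroup X G"
    and sym: "sym_group_on Y \<subseteq> {restrict_dom g Y | g. g \<in> G}"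
    and five: "five_conditions X Y G \<M>"
  shows "\<M> = {M. maximal_subsemigroup X M \<and> G \<subseteq> M}"
proof (intro set_eqI iffI)
  note below = proper_subsemigroup_below_member[OF Y G sym five]
  have mem: "G \<subseteq> M" "proper_subsemigroup X M" if "M \<in> \<M>" for M
    using five that by (simp_all add: five_conditions_def)
  have antichain: "M = N" if "M \<in> \<M>" "N \<in> \<M>" "M \<subseteq> N" for M N
    using five that unfolding five_conditions_def by meson
  show "M \<in> {M. maximal_subsemigroup X M \<and> G \<subseteq> M}" if M: "M \<in> \<M>" for M
  proof -
    have "N = M" if N: "proper_subsemigroup X N" "M \<subseteq> N" for N
    proof -
      obtain M' where "M' \<in> \<M>" "N \<subseteq> M'"
        using below[OF N(1)] mem(1)[OF M] N(2) by (meson subset_trans)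
      then show ?thesis
        using antichain[OF M] N(2) by (metis subset_antisym subset_trans)
    qed
    then show ?thesis
      using mem[OF M] by (auto simp: maximal_subsemigroup_def maximal_elements_def)
  qed
  show "M \<in> \<M>" if "M \<in> {M. maximal_subsemigroup X M \<and> G \<subseteq> M}" for M
  proof -
    have M: "proper_subsemigroup X M" "G \<subseteq> M"
      and max: "\<And>N. proper_subsemigroup X N \<Longrightarrow> M \<subseteq> N \<Longrightarrow> N = M"
      using that by (auto simp: maximal_subsemigroup_def maximal_elements_def)
    obtain N where "N \<in> \<M>" "M \<subseteq> N"
      using below[OF M] by blast
    then show ?thesis
      using max mem(2) by metis
  qed
qed

text \<open>
  The sets \<open>M \<inter> M\<^sup>-\<^sup>1\<close> form a cofinal subfamily of the proper inverse subsemigroups containing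
  \<open>G\<close>, so both families have the same maximal elements.
\<close>

lemma maximal_inverse_subsemigroups_from_five_conditions:
  assumes Y: "moiety X Y" and G: "inverse_subsemigroup X G"
    and sym: "sym_group_on Y \<subseteq> {restrict_dom g Y | g. g \<in> G}"
    and five: "five_conditions X Y G \<M>"
  shows "{N. maximal_inverse_subsemigroup X N \<and> G \<subseteq> N} =
    maximal_elements {M \<inter> inverse_set M | M. M \<in> \<M>}"
proof -
  define \<K> where "\<K> = {M \<inter> inverse_set M | M. M \<in> \<M>}"
  have member: "proper_inverse_subsemigroup X K \<and> G \<subseteq> K" if K_in: "K \<in> \<K>" for K
  proof -
    obtain M where M: "M \<in> \<M>" and K: "K = M \<inter> inverse_set M"
      using K_in by (auto simp: \<K>_def)
    have "G \<subseteq> M" "proper_subsemigroup X M"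
      using five M by (simp_all add: five_conditions_def)
    moreover from this have "G \<subseteq> inverse_set M"
      using inverse_set_mono_iff[of G M] inverse_set_inverse_subsemigroup[OF G] by simp
    ultimately show ?thesis
      using proper_inverse_subsemigroup_Int_inverse_set K by blast
  qed
  have cofinal: "\<exists>K\<in>\<K>. N \<subseteq> K" if N: "proper_inverse_subsemigroup X N" "G \<subseteq> N" for N
  proof -
    have "proper_subsemigroup X N" and inv: "inverse_set N = N"
      using N(1) inverse_set_inverse_subsemigroup
      by (auto simp: proper_inverse_subsemigroup_def inverse_subsemigroup_def
          proper_subsemigroup_def)
    then obtain M where M: "M \<in> \<M>" "N \<subseteq> M"
      using proper_subsemigroup_below_member[OF Y G sym five _ N(2)] by blast
    then have "N \<subseteq> M \<inter> inverse_set M"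
      using inverse_set_mono_iff[of N M] inv by simp
    then show ?thesis
      using M(1) by (auto simp: \<K>_def)
  qed
  have "{N. maximal_inverse_subsemigroup X N \<and> G \<subseteq> N} = maximal_elements \<K>"
  proof (intro set_eqI iffI)
    fix N assume "N \<in> {N. maximal_inverse_subsemigroup X N \<and> G \<subseteq> N}"
    then have N: "proper_inverse_subsemigroup X N" "G \<subseteq> N"
      and max: "\<And>K. proper_inverse_subsemigroup X K \<Longrightarrow> N \<subseteq> K \<Longrightarrow> K = N"
      by (auto simp: maximal_inverse_subsemigroup_def maximal_elements_def)
    obtain K where K: "K \<in> \<K>" "N \<subseteq> K"
      using cofinal[OF N] by blast
    then have "N \<in> \<K>"
      using max member by metis
    moreover have "\<forall>K\<in>\<K>. N \<subseteq> K \<longrightarrow> K = N"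
      using max member by blast
    ultimately show "N \<in> maximal_elements \<K>"
      unfolding maximal_elements_def by blast
  next
    fix K assume "K \<in> maximal_elements \<K>"
    then have K: "K \<in> \<K>" and max: "\<And>L. L \<in> \<K> \<Longrightarrow> K \<subseteq> L \<Longrightarrow> L = K"
      unfolding maximal_elements_def by blast+
    have "N = K" if N: "proper_inverse_subsemigroup X N" "K \<subseteq> N" for N
    proof -
      obtain L where "L \<in> \<K>" "N \<subseteq> L"
        using cofinal[OF N(1)] member[OF K] N(2) by blast
      then show ?thesis
        using max[of L] N(2) by blast
    qed
    then show "K \<in> {N. maximal_inverse_subsemigroup X N \<and> G \<subseteq> N}"
      using member[OF K] by (auto simp: maximal_inverse_subsemigroup_def maximal_elements_def)
  qed
  then show ?thesis
    by (simp only: \<K>_def)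
qed

theorem theorem2p7:
  fixes X Y :: "'a set" and G :: "'a rel set" and \<M> :: "'a rel set set"
  assumes "infinite X"
    and "moiety X Y"
    and "inverse_subsemigroup X G"
    and "sym_group_on Y \<subseteq> {restrict_dom g Y | g. g \<in> G}"
    and "\<M> \<subseteq> Pow (sym_inv_monoid X)"
  shows "(\<M> = {M. maximal_subsemigroup X M \<and> G \<subseteq> M} \<longleftrightarrow> five_conditions X Y G \<M>) \<and>
    (five_conditions X Y G \<M> \<longrightarrow>
      {N. maximal_inverse_subsemigroup X N \<and> G \<subseteq> N} =
      maximal_elements {M \<inter> inverse_set M | M. M \<in> \<M>})"
  using maximal_subsemigroups_satisfy_five_conditions[OF assms(2-4)]
    five_conditions_imp_maximal_subsemigroups[OF assms(2-4)]
    maximal_inverse_subsemigroups_from_five_conditions[OF assms(2-4)]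
  by blast

end
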